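(* Let $T\in M_n(\mathbb{C})$ and let $T=V|T|$ be its polar decomposition. Suppose that the spectrum of $V$ does not contain two opposite values, i.e. if $\lambda\neq\mu$ are two eigenvalues of $V$, then $\lambda+\mu\neq 0$. Then $M(T)$ is a unitary matrix if and only if $T=V$ and $T$ is a unitary matrix.
   Context: $M_n(\mathbb{C})$ is the algebra of $n\times n$ complex matrices. For $T\in M_n(\mathbb{C})$, $|T|=(T^*T)^{1/2}$, and the polar decomposition $T=V|T|$ is the canonical one: $V$ is the unique partial isometry with $T=V|T|$ and $\ker(V)=\ker(T)$. The mean transform of $T$ is $M(T)=\frac12(T+|T|V)$. *)

theory Defs
  imports
    Complex_Main
    "Jordan_Normal_Form.Schur_Decomposition"
    "Jordan_Normal_Form.Matrix_Kernel"
    "Jordan_Normal_Form.Spectral_Radius"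
begin

definition unitary_mat :: "complex mat \<Rightarrow> bool" where
  "unitary_mat U \<longleftrightarrow> square_mat U \<and>
     mat_adjoint U * U = 1\<^sub>m (dim_row U) \<and> U * mat_adjoint U = 1\<^sub>m (dim_row U)"

definition psd_mat :: "complex mat \<Rightarrow> bool" where
  "psd_mat P \<longleftrightarrow> square_mat P \<and> mat_adjoint P = P \<and>
     (\<forall>x \<in> carrier_vec (dim_row P). 0 \<le> Re ((P *\<^sub>v x) \<bullet>c x))"

text \<open>The modulus \<open>|T| = (T\<^sup>* T)\<^sup>1\<^sup>/\<^sup>2\<close>, i.e. the unique positive semidefinite
  square root of \<open>T\<^sup>* T\<close>.\<close>

definition mat_modulus :: "complex mat \<Rightarrow> complex mat" where
  "mat_modulus T = (THE P. P \<in> carrier_mat (dim_col T) (dim_col T) \<and> psd_mat P \<and>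
     P * P = mat_adjoint T * T)"

text \<open>The Euclidean norm; \<open>\<bullet>c\<close> conjugates its second argument, so \<open>x \<bullet>c x\<close> is
  real and nonnegative.\<close>

definition eucl_norm :: "complex vec \<Rightarrow> real" where
  "eucl_norm x = sqrt (Re (x \<bullet>c x))"

text \<open>A partial isometry preserves the norm on the orthogonal complement of its kernel.\<close>

definition partial_isometry :: "complex mat \<Rightarrow> bool" where
  "partial_isometry V \<longleftrightarrow>
     (\<forall>x \<in> carrier_vec (dim_col V). (\<forall>y \<in> mat_kernel V. x \<bullet>c y = 0) \<longrightarrow>
        eucl_norm (V *\<^sub>v x) = eucl_norm x)"

definition polar_decomposition :: "complex mat \<Rightarrow> complex mat \<Rightarrow> bool" where
  "polar_decomposition T V \<longleftrightarrow> V \<in> carrier_mat (dim_row T) (dim_col T) \<and>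
     partial_isometry V \<and> T = V * mat_modulus T \<and> mat_kernel V = mat_kernel T"

definition polar_factor :: "complex mat \<Rightarrow> complex mat" where
  "polar_factor T = (THE V. polar_decomposition T V)"

definition mean_transform :: "complex mat \<Rightarrow> complex mat" where
  "mean_transform T = (1 / 2) \<cdot>\<^sub>m (T + mat_modulus T * polar_factor T)"

end

theory Submission
  imports Defs
begin

text \<open>
  Let \<open>P = |T|\<close> and \<open>M = (V P + P V) / 2\<close>, the mean transform of \<open>T\<close>. Suppose that \<open>M\<close> is
  unitary. A vector in \<open>ker V = ker T\<close> is annihilated by \<open>M\<close>, so \<open>V\<close> is an injective partial
  isometry, that is, unitary. Then \<open>V\<^sup>* M = (P + V\<^sup>* P V) / 2\<close> is both unitary and positive
  semidefinite, so it is the identity (\<open>psd_unitary_eq_one\<close>). Hence \<open>M = V\<close>, which says that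
  \<open>Q = P - 1\<close> satisfies \<open>V Q = - Q V\<close>. This is a homogeneous Sylvester equation for \<open>V\<close> and
  \<open>- V\<close>; the hypothesis on opposite eigenvalues makes the two spectra disjoint, so \<open>Q = 0\<close>
  (\<open>anticommuting_mat_eq_0\<close>). Therefore \<open>P = 1\<close> and \<open>T = V\<close>. Conversely, if \<open>T = V\<close> is
  unitary then \<open>P\<^sup>2 = 1\<close>, so \<open>P = 1\<close> and \<open>M = T\<close>.

  The modulus and the polar factor are introduced by definite descriptions, so the argument also
  needs that they exist and are unique (\<open>mat_modulus_properties\<close>, \<open>polar_factor_eq\<close>). This rests
  on the diagonalization of Hermitian matrices (\<open>hermitian_diagonalization\<close>), which yields the
  square root itself and the criterion that a Hermitian matrix without nonzero real eigenvalues is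
  zero (\<open>hermitian_eq_0\<close>).
\<close>

section \<open>Adjoints and the inner product\<close>

lemma mat_adjoint_carrier [simp]:
  "A \<in> carrier_mat m n \<Longrightarrow> mat_adjoint A \<in> carrier_mat n m"
  by (auto simp: mat_adjoint_def)

lemma dim_mat_adjoint [simp]:
  "dim_row (mat_adjoint A) = dim_col A" "dim_col (mat_adjoint A) = dim_row A"
  by (auto simp: mat_adjoint_def)

lemma mat_adjoint_index [simp]:
  fixes A :: "complex mat"
  shows "i < dim_col A \<Longrightarrow> j < dim_row A \<Longrightarrow> mat_adjoint A $$ (i, j) = cnj (A $$ (j, i))"
  by (simp add: mat_adjoint_def mat_of_rows_index)

lemma mat_adjoint_mult:
  fixes A :: "complex mat"
  assumes "A \<in> carrier_mat m n" "B \<in> carrier_mat n k"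
  shows "mat_adjoint (A * B) = mat_adjoint B * mat_adjoint A"
  by (rule eq_matI) (use assms in \<open>auto simp: scalar_prod_def mult.commute\<close>)

lemma mat_adjoint_adjoint [simp]: "mat_adjoint (mat_adjoint A) = (A :: complex mat)"
  by (rule eq_matI) auto

lemma mat_adjoint_minus:
  fixes A :: "complex mat"
  assumes "A \<in> carrier_mat m n" "B \<in> carrier_mat m n"
  shows "mat_adjoint (A - B) = mat_adjoint A - mat_adjoint B"
  by (rule eq_matI) (use assms in auto)

lemma mat_adjoint_one [simp]: "mat_adjoint (1\<^sub>m n) = (1\<^sub>m n :: complex mat)"
  by (rule eq_matI) auto

lemma cscalar_prod_adjoint:
  fixes A :: "complex mat"
  assumes A: "A \<in> carrier_mat m n" and x: "x \<in> carrier_vec n" and y: "y \<in> carrier_vec m"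
  shows "(A *\<^sub>v x) \<bullet>c y = x \<bullet>c (mat_adjoint A *\<^sub>v y)"
proof -
  have "(A *\<^sub>v x) \<bullet>c y = (\<Sum>i<m. \<Sum>j<n. A $$ (i, j) * x $ j * cnj (y $ i))"
    using assms by (simp add: scalar_prod_def sum_distrib_right atLeast0LessThan)
  also have "\<dots> = (\<Sum>j<n. \<Sum>i<m. A $$ (i, j) * x $ j * cnj (y $ i))"
    by (rule sum.swap)
  also have "\<dots> = x \<bullet>c (mat_adjoint A *\<^sub>v y)"
    using assms by (simp add: scalar_prod_def sum_distrib_left atLeast0LessThan mult_ac)
  finally show ?thesis .
qed

lemma cscalar_prod_minus_right:
  fixes x y z :: "complex vec"
  assumes "x \<in> carrier_vec n" "y \<in> carrier_vec n" "z \<in> carrier_vec n"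
  shows "x \<bullet>c (y - z) = x \<bullet>c y - x \<bullet>c z"
  using assms by (simp add: scalar_prod_def sum_subtractf right_diff_distrib)

lemma cscalar_prod_self:
  fixes x :: "complex vec"
  shows "x \<bullet>c x = of_real (\<Sum>i<dim_vec x. (cmod (x $ i))\<^sup>2)"
  by (simp add: scalar_prod_def atLeast0LessThan complex_norm_square[symmetric] del: of_real_power)

lemma Re_cscalar_prod_self_ge_0: "0 \<le> Re ((x :: complex vec) \<bullet>c x)"
  by (simp add: cscalar_prod_self sum_nonneg)

lemma cscalar_prod_self_eq_of_real_Re: "(x :: complex vec) \<bullet>c x = of_real (Re (x \<bullet>c x))"
  by (simp add: cscalar_prod_self)

lemma Re_cscalar_prod_self_eq_0_iff:
  fixes x :: "complex vec"
  assumes "x \<in> carrier_vec n"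
  shows "Re (x \<bullet>c x) = 0 \<longleftrightarrow> x = 0\<^sub>v n"
  using conjugate_square_eq_0_vec[OF assms] cscalar_prod_self_eq_of_real_Re[of x]
  by (metis of_real_0 zero_complex.simps(1))

lemma adjoint_mult_index:
  fixes A :: "complex mat"
  assumes "A \<in> carrier_mat m n" "i < n" "j < n"
  shows "(mat_adjoint A * A) $$ (i, j) = col A j \<bullet>c col A i"
  using assms by (simp add: scalar_prod_def mult.commute)

lemma zero_mat_mult_vec [simp]:
  "(x :: 'a :: semiring_0 vec) \<in> carrier_vec n \<Longrightarrow> 0\<^sub>m m n *\<^sub>v x = 0\<^sub>v m"
  by (intro eq_vecI) auto

lemma mat_mult_zero_vec [simp]:
  "(A :: 'a :: semiring_0 mat) \<in> carrier_mat m n \<Longrightarrow> A *\<^sub>v 0\<^sub>v n = 0\<^sub>v m"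
  by (intro eq_vecI) auto

lemma eq_0_if_adjoint_mult_self_eq_0:
  fixes X :: "complex mat"
  assumes X: "X \<in> carrier_mat m n" and z: "mat_adjoint X * X = 0\<^sub>m n n"
  shows "X = 0\<^sub>m m n"
proof (rule mat_col_eqI)
  fix i assume "i < dim_col (0\<^sub>m m n :: complex mat)"
  hence i: "i < n" by simp
  have "col X i \<bullet>c col X i = 0"
    using adjoint_mult_index[OF X i i] z i by simp
  thus "col X i = col (0\<^sub>m m n) i" using conjugate_square_eq_0_vec[of "col X i" m] X i by auto
qed (use X in auto)

lemma mat_eq_0_if_mult_vec_0:
  fixes A :: "complex mat"
  assumes A: "A \<in> carrier_mat m n"
    and z: "\<And>x. x \<in> carrier_vec n \<Longrightarrow> A *\<^sub>v x = 0\<^sub>v m"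
  shows "A = 0\<^sub>m m n"
proof (rule mat_col_eqI)
  fix i assume "i < dim_col (0\<^sub>m m n :: complex mat)"
  hence i: "i < n" by simp
  have "col A i = A *\<^sub>v col (1\<^sub>m n) i"
    using col_mult2[OF A one_carrier_mat i] A by simp
  also have "\<dots> = col (0\<^sub>m m n) i" using i by (subst z) auto
  finally show "col A i = col (0\<^sub>m m n) i" .
qed (use A in auto)

lemma minus_mat_eq_0D:
  fixes A :: "complex mat"
  assumes "A \<in> carrier_mat m n" "B \<in> carrier_mat m n" "A - B = 0\<^sub>m m n"
  shows "A = B"
proof (rule eq_matI)
  fix i j assume ij: "i < dim_row B" "j < dim_col B"
  thus "A $$ (i, j) = B $$ (i, j)"
    using assms(1,2) arg_cong[OF assms(3), of "\<lambda>M. M $$ (i, j)"] by simp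
qed (use assms in auto)

section \<open>Unitary matrices\<close>

lemma square_mult_carrier [simp]:
  "A \<in> carrier_mat n n \<Longrightarrow> B \<in> carrier_mat n n \<Longrightarrow> A * B \<in> carrier_mat n n"
  by (rule mult_carrier_mat)

lemma unitary_mat_iff:
  assumes U: "U \<in> carrier_mat n n"
  shows "unitary_mat U \<longleftrightarrow> mat_adjoint U * U = 1\<^sub>m n"
  using mat_mult_left_right_inverse[OF mat_adjoint_carrier[OF U] U] U
  by (auto simp: unitary_mat_def)

lemma unitary_matD:
  assumes "U \<in> carrier_mat n n" "unitary_mat U"
  shows "mat_adjoint U * U = 1\<^sub>m n" "U * mat_adjoint U = 1\<^sub>m n"
  using assms by (auto simp: unitary_mat_def)

lemma unitary_mat_mult:
  assumes U: "U \<in> carrier_mat n n" "unitary_mat U" and W: "W \<in> carrier_mat n n" "unitary_mat W"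
  shows "unitary_mat (U * W)"
proof -
  have "mat_adjoint (U * W) * (U * W) = mat_adjoint W * ((mat_adjoint U * U) * W)"
    using U(1) W(1) by (simp add: mat_adjoint_mult[of _ n n _ n] assoc_mult_mat[of _ n n _ n _ n])
  also have "\<dots> = 1\<^sub>m n"
    using unitary_matD[OF U] unitary_matD[OF W] W(1) by simp
  finally show ?thesis using U W by (subst unitary_mat_iff[of _ n]) auto
qed

lemma unitary_mat_adjoint:
  assumes "U \<in> carrier_mat n n" "unitary_mat U"
  shows "unitary_mat (mat_adjoint U)"
  using assms by (auto simp: unitary_mat_def)

lemma eigenvalue_exists:
  assumes A: "(A :: complex mat) \<in> carrier_mat n n" and n: "0 < n"
  shows "\<exists>e v. v \<in> carrier_vec n \<and> v \<noteq> 0\<^sub>v n \<and> A *\<^sub>v v = e \<cdot>\<^sub>v v"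
  using spectrum_non_empty[OF A n] A
  by (auto simp: spectrum_def eigenvalue_def eigenvector_def)

text \<open>Extend \<open>v\<close> to a basis, apply Gram--Schmidt, and normalize the resulting orthogonal columns.\<close>

lemma unitary_with_first_column:
  fixes v :: "complex vec"
  assumes v: "v \<in> carrier_vec n" and v0: "v \<noteq> 0\<^sub>v n" and n: "0 < n"
  shows "\<exists>U c. U \<in> carrier_mat n n \<and> unitary_mat U \<and> col U 0 = c \<cdot>\<^sub>v v"
proof -
  interpret cof_vec_space n "TYPE(complex)" .
  define b where "b = basis_completion v"
  define ws where "ws = gram_schmidt n b"
  note bc = basis_completion[OF v v0, folded b_def]
  note gs = gram_schmidt_result[OF bc(2,4,5) ws_def]
  have len: "length ws = n" using gs(4) bc(6) by simp
  obtain vs where "b = v # vs" using bc(6,7) n by (cases b) auto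
  hence "hd ws = v" using gram_schmidt_hd[OF v, of vs] by (simp add: ws_def)
  hence hd: "ws ! 0 = v" using hd_conv_nth[of ws] len n by (cases ws) auto
  have wsc: "ws ! i \<in> carrier_vec n" if "i < n" for i using gs(3) len that by auto
  define c where "c i = complex_of_real (1 / sqrt (Re (ws ! i \<bullet>c ws ! i)))" for i
  define U where "U = mat n n (\<lambda>(i, j). (c j \<cdot>\<^sub>v ws ! j) $ i)"
  have U: "U \<in> carrier_mat n n" by (simp add: U_def)
  have colU: "col U j = c j \<cdot>\<^sub>v ws ! j" if "j < n" for j
    using that wsc[OF that] by (intro eq_vecI) (auto simp: U_def)
  have "mat_adjoint U * U = 1\<^sub>m n"
  proof (rule eq_matI)
    fix i j assume "i < dim_row (1\<^sub>m n :: complex mat)" "j < dim_col (1\<^sub>m n :: complex mat)"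
    hence ij: "i < n" "j < n" by auto
    have "(mat_adjoint U * U) $$ (i, j) = (c j \<cdot>\<^sub>v ws ! j) \<bullet>c (c i \<cdot>\<^sub>v ws ! i)"
      using adjoint_mult_index[OF U ij] colU ij by simp
    also have "\<dots> = c j * c i * (ws ! j \<bullet>c ws ! i)"
      using wsc[OF ij(1)] wsc[OF ij(2)] by (simp add: conjugate_smult_vec c_def)
    also have "\<dots> = (if i = j then 1 else 0)"
    proof (cases "i = j")
      case True
      let ?r = "Re (ws ! i \<bullet>c ws ! i)"
      have r0: "ws ! i \<bullet>c ws ! i \<noteq> 0" using corthogonalD[OF gs(2), of i i] len ij by simp
      hence "0 < ?r"
        using Re_cscalar_prod_self_ge_0[of "ws ! i"] cscalar_prod_self_eq_of_real_Re[of "ws ! i"]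
        by (metis less_le of_real_0)
      hence "1 / sqrt ?r * (1 / sqrt ?r) * ?r = 1" by (simp add: field_simps)
      hence "complex_of_real (1 / sqrt ?r) * complex_of_real (1 / sqrt ?r) * complex_of_real ?r = 1"
        by (metis of_real_1 of_real_mult)
      thus ?thesis
        unfolding c_def True[symmetric] by (subst cscalar_prod_self_eq_of_real_Re) simp
    next
      case False
      thus ?thesis using corthogonalD[OF gs(2), of j i] len ij by simp
    qed
    finally show "(mat_adjoint U * U) $$ (i, j) = 1\<^sub>m n $$ (i, j)" using ij by simp
  qed (use U in auto)
  thus ?thesis using U colU[OF n] hd unitary_mat_iff[OF U] by auto
qed

section \<open>Diagonalization of Hermitian matrices\<close>

definition unitary_diag :: "nat \<Rightarrow> complex mat \<Rightarrow> (nat \<Rightarrow> real) \<Rightarrow> complex mat" where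
  "unitary_diag n U d = U * mat_diag n (\<lambda>i. complex_of_real (d i)) * mat_adjoint U"

lemma adjoint_four_block_diag:
  fixes A :: "complex mat"
  assumes "A \<in> carrier_mat k k" "D \<in> carrier_mat n n"
  shows "mat_adjoint (four_block_mat A (0\<^sub>m k n) (0\<^sub>m n k) D)
    = four_block_mat (mat_adjoint A) (0\<^sub>m k n) (0\<^sub>m n k) (mat_adjoint D)"
  by (rule eq_matI) (use assms in auto)

lemma mult_four_block_diag:
  fixes A :: "complex mat"
  assumes "A \<in> carrier_mat k k" "D \<in> carrier_mat n n" "A' \<in> carrier_mat k k" "D' \<in> carrier_mat n n"
  shows "four_block_mat A (0\<^sub>m k n) (0\<^sub>m n k) D * four_block_mat A' (0\<^sub>m k n) (0\<^sub>m n k) D'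
    = four_block_mat (A * A') (0\<^sub>m k n) (0\<^sub>m n k) (D * D')"
  by (subst mult_four_block_mat[of _ k k _ n _ n _ _ k _ n]) (use assms in auto)

text \<open>By induction on the dimension. A unitary matrix whose first column is an eigenvector conjugates
  \<open>H\<close> to a matrix whose first column is a multiple of the first unit vector; being Hermitian,
  that matrix has the same first row, so it splits into a real scalar and a smaller Hermitian block.\<close>

lemma hermitian_diagonalization:
  fixes H :: "complex mat"
  assumes "H \<in> carrier_mat n n" "mat_adjoint H = H"
  shows "\<exists>U d. U \<in> carrier_mat n n \<and> unitary_mat U \<and> H = unitary_diag n U d"
  using assms
proof (induction n arbitrary: H)
  case 0
  have "unitary_mat (1\<^sub>m 0)" by (simp add: unitary_mat_def)
  moreover have "H = unitary_diag 0 (1\<^sub>m 0) (\<lambda>_. 0)"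
    using 0 by (intro eq_matI) (auto simp: unitary_diag_def)
  ultimately show ?case by (intro exI[of _ "1\<^sub>m 0"] exI[of _ "\<lambda>_. 0"]) auto
next
  case (Suc n)
  let ?m = "Suc n"
  note H = Suc.prems
  obtain e v where v: "v \<in> carrier_vec ?m" "v \<noteq> 0\<^sub>v ?m" "H *\<^sub>v v = e \<cdot>\<^sub>v v"
    using eigenvalue_exists[OF H(1)] by auto
  obtain U c where U: "U \<in> carrier_mat ?m ?m" "unitary_mat U" and U0: "col U 0 = c \<cdot>\<^sub>v v"
    using unitary_with_first_column[OF v(1,2)] by auto
  note adj [simp] = mat_adjoint_carrier[OF U(1)]
  define B where "B = mat_adjoint U * (H * U)"
  have B: "B \<in> carrier_mat ?m ?m" using H U by (simp add: B_def)
  have Bh: "mat_adjoint B = B"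
    using U H
    by (simp add: B_def mat_adjoint_mult[of _ ?m ?m _ ?m] assoc_mult_mat[of _ ?m ?m _ ?m _ ?m])
  have u0: "col U 0 \<in> carrier_vec ?m" using U0 v(1) by simp
  have "H *\<^sub>v col U 0 = e \<cdot>\<^sub>v col U 0"
    using v H by (simp add: U0 mult_mat_vec[OF H(1) v(1)] smult_smult_assoc mult.commute)
  hence colB: "col B 0 = e \<cdot>\<^sub>v col (mat_adjoint U * U) 0"
    unfolding B_def col_mult2[OF adj square_mult_carrier[OF H(1) U(1)] zero_less_Suc]
      col_mult2[OF H(1) U(1) zero_less_Suc] col_mult2[OF adj U(1) zero_less_Suc]
    by (simp only: mult_mat_vec[OF adj u0])
  hence B0: "B $$ (i, 0) = (if i = 0 then e else 0)" if "i < ?m" for i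
  proof -
    have "B $$ (i, 0) = col B 0 $ i" using that B by simp
    also have "\<dots> = e * 1\<^sub>m ?m $$ (i, 0)" unfolding colB unitary_matD[OF U] using that by simp
    finally show ?thesis using that by simp
  qed
  have B0': "B $$ (0, i) = (if i = 0 then cnj e else 0)" if "i < ?m" for i
    using that B0[OF that] B arg_cong[OF Bh, of "\<lambda>M. M $$ (0, i)"] by auto
  have cnj_e: "cnj e = e" using B0[of 0] B0'[of 0] by simp
  hence e: "e = of_real (Re e)" by (simp add: complex_eq_iff)
  define C where "C = mat n n (\<lambda>(i, j). B $$ (Suc i, Suc j))"
  have C: "C \<in> carrier_mat n n" by (simp add: C_def)
  have "mat_adjoint C = C"
  proof (rule eq_matI)
    fix i j assume "i < dim_row C" "j < dim_col C"
    thus "mat_adjoint C $$ (i, j) = C $$ (i, j)"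
      using B arg_cong[OF Bh, of "\<lambda>M. M $$ (Suc i, Suc j)"] by (simp add: C_def)
  qed (use C in auto)
  then obtain W d where W: "W \<in> carrier_mat n n" "unitary_mat W" and CW: "C = unitary_diag n W d"
    using Suc.IH[OF C] by blast
  define d' where "d' = case_nat (Re e) d"
  define W' where "W' = four_block_mat (1\<^sub>m 1) (0\<^sub>m 1 n) (0\<^sub>m n 1) W"
  have W': "W' \<in> carrier_mat ?m ?m" using W by (auto simp: W'_def)
  have "unitary_mat W'"
    using W' W(1) unitary_matD[OF W]
    by (subst unitary_mat_iff[OF W']) (simp add: W'_def adjoint_four_block_diag mult_four_block_diag)
  have D: "mat_diag ?m (\<lambda>i. complex_of_real (d' i))
    = four_block_mat (mat_diag 1 (\<lambda>_. e)) (0\<^sub>m 1 n) (0\<^sub>m n 1)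
      (mat_diag n (\<lambda>i. complex_of_real (d i)))" (is "?D = ?D'")
    by (rule eq_matI) (use e in \<open>auto simp: mat_diag_def d'_def split: nat.split\<close>)
  note e1 = mat_diag_dim[of 1 "\<lambda>_. e"] and d1 = mat_diag_dim[of n "\<lambda>i. complex_of_real (d i)"]
  have "B = four_block_mat (mat_diag 1 (\<lambda>_. e)) (0\<^sub>m 1 n) (0\<^sub>m n 1) C"
    by (rule eq_matI) (use B B0 B0' cnj_e in \<open>auto simp: mat_diag_def C_def\<close>)
  also have "\<dots> = W' * ?D * mat_adjoint W'"
    unfolding D W'_def CW unitary_diag_def adjoint_four_block_diag[OF one_carrier_mat W(1)]
      mult_four_block_diag[OF one_carrier_mat W(1) e1 d1] mat_adjoint_one
      mult_four_block_diag[OF e1 mult_carrier_mat[OF W(1) d1]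
        one_carrier_mat mat_adjoint_carrier[OF W(1)]] left_mult_one_mat[OF e1] right_mult_one_mat[OF e1] ..
  finally have BW: "B = W' * ?D * mat_adjoint W'" .
  have "H = (U * mat_adjoint U) * H * (U * mat_adjoint U)"
    using unitary_matD[OF U] H by simp
  also have "\<dots> = U * B * mat_adjoint U"
    using U H by (simp add: B_def assoc_mult_mat[of _ ?m ?m _ ?m _ ?m])
  also have "\<dots> = unitary_diag ?m (U * W') d'"
    using U W' mat_diag_dim[of ?m]
    by (simp add: BW unitary_diag_def mat_adjoint_mult[of _ ?m ?m _ ?m]
        assoc_mult_mat[of _ ?m ?m _ ?m _ ?m])
  finally show ?case
    using unitary_mat_mult[OF U W' \<open>unitary_mat W'\<close>] U W' by (intro exI[of _ "U * W'"] exI[of _ d']) auto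
qed

text \<open>The columns of a diagonalizing unitary matrix are nonzero eigenvectors with real eigenvalues,
  so a Hermitian matrix can be shown to vanish by testing it on such vectors alone.\<close>

lemma hermitian_eq_0:
  fixes H :: "complex mat"
  assumes H: "H \<in> carrier_mat n n" "mat_adjoint H = H"
    and ev: "\<And>x r. x \<in> carrier_vec n \<Longrightarrow> H *\<^sub>v x = complex_of_real r \<cdot>\<^sub>v x \<Longrightarrow> r = 0 \<or> x = 0\<^sub>v n"
  shows "H = 0\<^sub>m n n"
proof -
  obtain U d where U: "U \<in> carrier_mat n n" "unitary_mat U" and HU: "H = unitary_diag n U d"
    using hermitian_diagonalization[OF H] by blast
  let ?D = "mat_diag n (\<lambda>i. complex_of_real (d i))"
  note adj [simp] = mat_adjoint_carrier[OF U(1)]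
  have "H * U = U * ?D * (mat_adjoint U * U)"
    unfolding HU unitary_diag_def using U(1) by (simp add: assoc_mult_mat[of _ n n _ n _ n])
  hence eq: "H * U = mat n n (\<lambda>(i, j). U $$ (i, j) * complex_of_real (d j))"
    using U(1) unitary_matD[OF U] by (simp add: mat_diag_mult_right right_mult_one_mat[of _ n n])
  have "d j = 0" if j: "j < n" for j
  proof -
    have c: "col U j \<in> carrier_vec n" using U(1) by auto
    have "H *\<^sub>v col U j = complex_of_real (d j) \<cdot>\<^sub>v col U j"
      using arg_cong[OF eq, of "\<lambda>M. col M j"] col_mult2[OF H(1) U(1) j] U(1) j
      by (auto intro!: eq_vecI)
    from ev[OF c this] show "d j = 0"
    proof
      assume "col U j = 0\<^sub>v n"
      hence "(mat_adjoint U * U) $$ (j, j) = 0"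
        unfolding adjoint_mult_index[OF U(1) j j] by simp
      thus ?thesis using unitary_matD[OF U] j by simp
    qed
  qed
  hence "?D = 0\<^sub>m n n" by (intro eq_matI) (auto simp: mat_diag_def)
  thus ?thesis unfolding HU unitary_diag_def using U(1) by simp
qed

lemma unitary_diag_carrier [simp]: "U \<in> carrier_mat n n \<Longrightarrow> unitary_diag n U d \<in> carrier_mat n n"
  by (auto simp: unitary_diag_def intro!: mult_carrier_mat[of _ n n])

lemma mat_adjoint_unitary_diag:
  assumes "U \<in> carrier_mat n n"
  shows "mat_adjoint (unitary_diag n U d) = unitary_diag n U d"
proof -
  let ?D = "mat_diag n (\<lambda>i. complex_of_real (d i))"
  note [simp] = mat_adjoint_carrier[OF assms]
  have "mat_adjoint ?D = ?D" by (rule eq_matI) (auto simp: mat_diag_def)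
  thus ?thesis using assms
    by (simp add: unitary_diag_def mat_adjoint_mult[of _ n n _ n] assoc_mult_mat[of _ n n _ n _ n])
qed

lemma unitary_diag_mult:
  assumes U: "U \<in> carrier_mat n n" "unitary_mat U"
  shows "unitary_diag n U d * unitary_diag n U e = unitary_diag n U (\<lambda>i. d i * e i)"
proof -
  let ?D = "\<lambda>d. mat_diag n (\<lambda>i. complex_of_real (d i))"
  note [simp] = mat_adjoint_carrier[OF U(1)] mat_diag_dim
  have "unitary_diag n U d * unitary_diag n U e
      = U * ?D d * (mat_adjoint U * U) * ?D e * mat_adjoint U"
    using U(1) by (simp add: unitary_diag_def assoc_mult_mat[of _ n n _ n _ n] del: mat_diag_diag)
  also have "\<dots> = U * (?D d * ?D e) * mat_adjoint U"
    unfolding unitary_matD(1)[OF U] using U(1)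
    by (simp add: assoc_mult_mat[of _ n n _ n _ n] right_mult_one_mat[of _ n n]
        left_mult_one_mat[of _ n n] del: mat_diag_diag)
  finally show ?thesis by (simp add: unitary_diag_def)
qed

text \<open>An eigenvector \<open>x\<close> of the Hermitian matrix \<open>V\<^sup>* V - 1\<close> with eigenvalue \<open>r\<close> satisfies
  \<open>r \<parallel>x\<parallel>\<^sup>2 = \<parallel>V x\<parallel>\<^sup>2 - \<parallel>x\<parallel>\<^sup>2 = 0\<close>.\<close>

lemma unitary_if_norm_preserving:
  assumes V: "V \<in> carrier_mat n n"
    and iso: "\<And>x. x \<in> carrier_vec n \<Longrightarrow> eucl_norm (V *\<^sub>v x) = eucl_norm x"
  shows "unitary_mat V"
proof -
  let ?H = "mat_adjoint V * V"
  note adjV = mat_adjoint_carrier[OF V]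
  have H: "?H \<in> carrier_mat n n" using V adjV by simp
  have "?H - 1\<^sub>m n = 0\<^sub>m n n"
  proof (rule hermitian_eq_0)
    show "?H - 1\<^sub>m n \<in> carrier_mat n n" by (rule minus_carrier_mat) simp
    show "mat_adjoint (?H - 1\<^sub>m n) = ?H - 1\<^sub>m n"
      by (simp add: mat_adjoint_minus[OF H one_carrier_mat] mat_adjoint_mult[OF adjV V])
    fix x r assume x: "x \<in> carrier_vec n" and "(?H - 1\<^sub>m n) *\<^sub>v x = complex_of_real r \<cdot>\<^sub>v x"
    hence "?H *\<^sub>v x - x = of_real r \<cdot>\<^sub>v x"
      using minus_mult_distrib_mat_vec[OF H one_carrier_mat x] by simp
    hence "(?H *\<^sub>v x) \<bullet>c x - x \<bullet>c x = of_real r * (x \<bullet>c x)"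
      using minus_scalar_prod_distrib[of "?H *\<^sub>v x" n x "conjugate x"] H x by simp
    moreover have "(?H *\<^sub>v x) \<bullet>c x = (V *\<^sub>v x) \<bullet>c (V *\<^sub>v x)"
      using cscalar_prod_adjoint[OF adjV _ x, of "V *\<^sub>v x"] V x assoc_mult_mat_vec[OF adjV V x] by simp
    moreover have "Re ((V *\<^sub>v x) \<bullet>c (V *\<^sub>v x)) = Re (x \<bullet>c x)"
      using iso[OF x] by (simp add: eucl_norm_def)
    ultimately have "r * Re (x \<bullet>c x) = 0" by (simp add: complex_eq_iff)
    thus "r = 0 \<or> x = 0\<^sub>v n" using Re_cscalar_prod_self_eq_0_iff[OF x] by simp
  qed
  thus ?thesis using minus_mat_eq_0D[OF H one_carrier_mat] unitary_mat_iff[OF V] by simp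
qed

section \<open>Positive semidefinite matrices and the modulus\<close>

lemma psd_mat_square:
  assumes R: "R \<in> carrier_mat n n" "mat_adjoint R = R"
  shows "psd_mat (R * R)"
  unfolding psd_mat_def
proof (intro conjI ballI)
  show "square_mat (R * R)" "mat_adjoint (R * R) = R * R"
    using R by (auto simp: mat_adjoint_mult[of _ n n _ n])
  fix x :: "complex vec" assume "x \<in> carrier_vec (dim_row (R * R))"
  hence x: "x \<in> carrier_vec n" using R by simp
  have "(R * R *\<^sub>v x) \<bullet>c x = (R *\<^sub>v x) \<bullet>c (R *\<^sub>v x)"
    using cscalar_prod_adjoint[OF R(1) mult_mat_vec_carrier[OF R(1) x] x] R x by simp
  thus "0 \<le> Re ((R * R *\<^sub>v x) \<bullet>c x)" using Re_cscalar_prod_self_ge_0 by simp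
qed

lemma psd_mat_one: "psd_mat (1\<^sub>m n)"
  using psd_mat_square[of "1\<^sub>m n" n] by simp

lemma psd_mat_midpoint:
  assumes A: "A \<in> carrier_mat n n" "psd_mat A" and B: "B \<in> carrier_mat n n" "psd_mat B"
  shows "psd_mat ((1 / 2) \<cdot>\<^sub>m (A + B))"
  unfolding psd_mat_def
proof (intro conjI ballI)
  let ?M = "(1 / 2) \<cdot>\<^sub>m (A + B)"
  show "square_mat ?M" using A(1) B(1) by simp
  have "mat_adjoint ?M = (1 / 2) \<cdot>\<^sub>m (mat_adjoint A + mat_adjoint B)"
    by (rule eq_matI) (use A(1) B(1) in auto)
  thus "mat_adjoint ?M = ?M" using A(2) B(2) by (simp add: psd_mat_def)
  fix x :: "complex vec" assume "x \<in> carrier_vec (dim_row ?M)"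
  hence x: "x \<in> carrier_vec n" using A(1) B(1) by simp
  have Ax: "A *\<^sub>v x \<in> carrier_vec n" and Bx: "B *\<^sub>v x \<in> carrier_vec n" using A B x by auto
  have cx: "conjugate x \<in> carrier_vec n" using x by simp
  have "?M *\<^sub>v x = (1 / 2) \<cdot>\<^sub>v (A *\<^sub>v x + B *\<^sub>v x)"
    unfolding add_mult_distrib_mat_vec[OF A(1) B(1) x, symmetric]
    by (rule eq_vecI) (use A(1) B(1) x in auto)
  hence "(?M *\<^sub>v x) \<bullet>c x = (1 / 2) * ((A *\<^sub>v x) \<bullet>c x + (B *\<^sub>v x) \<bullet>c x)"
    by (simp only: add_scalar_prod_distrib[OF Ax Bx cx]
        smult_scalar_prod_distrib[OF add_carrier_vec[OF Ax Bx] cx])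
  moreover have "0 \<le> Re ((A *\<^sub>v x) \<bullet>c x)" "0 \<le> Re ((B *\<^sub>v x) \<bullet>c x)"
    using A B x by (auto simp: psd_mat_def)
  hence "0 \<le> Re ((1 / 2) * ((A *\<^sub>v x) \<bullet>c x + (B *\<^sub>v x) \<bullet>c x))" by simp
  ultimately show "0 \<le> Re ((?M *\<^sub>v x) \<bullet>c x)" by (simp only:)
qed

lemma psd_mat_congruence:
  assumes P: "P \<in> carrier_mat n n" "psd_mat P" and V: "V \<in> carrier_mat n n"
  shows "psd_mat (mat_adjoint V * (P * V))"
  unfolding psd_mat_def
proof (intro conjI ballI)
  note adjV [simp] = mat_adjoint_carrier[OF V]
  have Ph: "mat_adjoint P = P" using P by (simp add: psd_mat_def)
  show "square_mat (mat_adjoint V * (P * V))" using V by simp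
  show "mat_adjoint (mat_adjoint V * (P * V)) = mat_adjoint V * (P * V)"
    using P(1) V Ph by (simp add: mat_adjoint_mult[of _ n n _ n] assoc_mult_mat[of _ n n _ n _ n])
  fix x :: "complex vec" assume "x \<in> carrier_vec (dim_row (mat_adjoint V * (P * V)))"
  hence x: "x \<in> carrier_vec n" using V by simp
  have Vx: "V *\<^sub>v x \<in> carrier_vec n" using V x by simp
  have "(mat_adjoint V * (P * V)) *\<^sub>v x = mat_adjoint V *\<^sub>v (P *\<^sub>v (V *\<^sub>v x))"
    using P(1) V x Vx by (simp add: assoc_mult_mat_vec[of _ n n _ n])
  hence "((mat_adjoint V * (P * V)) *\<^sub>v x) \<bullet>c x = (P *\<^sub>v (V *\<^sub>v x)) \<bullet>c (V *\<^sub>v x)"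
    using cscalar_prod_adjoint[OF adjV _ x] P(1) Vx by simp
  thus "0 \<le> Re (((mat_adjoint V * (P * V)) *\<^sub>v x) \<bullet>c x)"
    using P Vx by (auto simp: psd_mat_def)
qed

text \<open>Diagonalize \<open>T\<^sup>* T\<close>. Its eigenvalues are squared norms of columns of \<open>T U\<close>, hence
  nonnegative, and the square root is found by taking roots of the diagonal entries.\<close>

lemma psd_sqrt_exists:
  fixes T :: "complex mat"
  assumes T: "T \<in> carrier_mat m n"
  shows "\<exists>P. P \<in> carrier_mat n n \<and> psd_mat P \<and> P * P = mat_adjoint T * T"
proof -
  let ?A = "mat_adjoint T * T"
  note adjT = mat_adjoint_carrier[OF T]
  have A: "?A \<in> carrier_mat n n" "mat_adjoint ?A = ?A"
    using mult_carrier_mat[OF adjT T] by (auto simp: mat_adjoint_mult[OF adjT T])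
  obtain U d where U: "U \<in> carrier_mat n n" "unitary_mat U" and AU: "?A = unitary_diag n U d"
    using hermitian_diagonalization[OF A] by blast
  let ?D = "mat_diag n (\<lambda>i. complex_of_real (d i))"
  note [simp] = mat_adjoint_carrier[OF U(1)]
  have TU: "T * U \<in> carrier_mat m n" using T U by simp
  have "mat_adjoint (T * U) * (T * U) = mat_adjoint U * (?A * U)"
    using mult_carrier_mat[OF T U(1)] adjT
    by (simp add: mat_adjoint_mult[OF T U(1)]
        assoc_mult_mat[OF mat_adjoint_carrier[OF U(1)] adjT TU] assoc_mult_mat[OF adjT T U(1)])
  also have "\<dots> = (mat_adjoint U * U) * ?D * (mat_adjoint U * U)"
    unfolding AU unitary_diag_def using U(1) by (simp add: assoc_mult_mat[of _ n n _ n _ n])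
  finally have D: "mat_adjoint (T * U) * (T * U) = ?D"
    unfolding unitary_matD(1)[OF U] by (simp add: left_mult_one_mat[of _ n n] right_mult_one_mat[of _ n n])
  have d0: "0 \<le> d i" if "i < n" for i
    using arg_cong[OF D, of "\<lambda>M. Re (M $$ (i, i))"] that Re_cscalar_prod_self_ge_0[of "col (T * U) i"]
    by (simp add: adjoint_mult_index[OF TU] mat_diag_def del: col_mult2)
  \<comment> \<open>Fourth roots of the eigenvalues: the wanted root \<open>R * R\<close> is then the square of a Hermitian
    matrix, which makes it positive semidefinite at once.\<close>
  define R where "R = unitary_diag n U (\<lambda>i. sqrt (sqrt (d i)))"
  have "R * R * (R * R) = unitary_diag n U
      (\<lambda>i. (sqrt (sqrt (d i)) * sqrt (sqrt (d i))) * (sqrt (sqrt (d i)) * sqrt (sqrt (d i))))"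
    by (simp only: R_def unitary_diag_mult[OF U])
  also have "\<dots> = unitary_diag n U d"
    unfolding unitary_diag_def
    by (intro arg_cong[where f = "\<lambda>D. U * D * mat_adjoint U"] eq_matI) (auto simp: mat_diag_def d0)
  finally have "R * R * (R * R) = ?A" using AU by simp
  thus ?thesis
    using psd_mat_square[of R n] U(1) mat_adjoint_unitary_diag[OF U(1)]
    by (intro exI[of _ "R * R"]) (auto simp: R_def)
qed

text \<open>Let \<open>x\<close> be an eigenvector of \<open>P - R\<close> with eigenvalue \<open>r \<noteq> 0\<close>. From \<open>P\<^sup>2 = R\<^sup>2\<close> one
  gets \<open>\<parallel>P x\<parallel> = \<parallel>R x\<parallel>\<close>, which turns into \<open>r (\<langle>P x, x\<rangle> + \<langle>R x, x\<rangle>) = 0\<close>. Both summands are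
  nonnegative, so both vanish, and so does their difference \<open>r \<parallel>x\<parallel>\<^sup>2\<close>.\<close>

lemma psd_sqrt_unique:
  assumes P: "P \<in> carrier_mat n n" "psd_mat P" and R: "R \<in> carrier_mat n n" "psd_mat R"
    and eq: "P * P = R * R"
  shows "P = R"
proof (rule minus_mat_eq_0D[OF P(1) R(1)], rule hermitian_eq_0)
  have Ph: "mat_adjoint P = P" and Rh: "mat_adjoint R = R"
    using P R by (auto simp: psd_mat_def)
  show X: "P - R \<in> carrier_mat n n" using P R by auto
  show "mat_adjoint (P - R) = P - R" using mat_adjoint_minus[OF P(1) R(1)] Ph Rh by simp
  fix x and r :: real
  assume x: "x \<in> carrier_vec n" and "(P - R) *\<^sub>v x = of_real r \<cdot>\<^sub>v x"
  hence Xx: "P *\<^sub>v x - R *\<^sub>v x = of_real r \<cdot>\<^sub>v x"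
    using minus_mult_distrib_mat_vec[OF P(1) R(1) x] by simp
  have Px: "P *\<^sub>v x \<in> carrier_vec n" and Rx: "R *\<^sub>v x \<in> carrier_vec n" using P R x by auto
  have cx: "conjugate x \<in> carrier_vec n" using x by simp
  let ?p = "(P *\<^sub>v x) \<bullet>c x" and ?q = "(R *\<^sub>v x) \<bullet>c x"
  have diff: "?p - ?q = of_real r * (x \<bullet>c x)"
    using arg_cong[OF Xx, of "\<lambda>v. v \<bullet>c x"] minus_scalar_prod_distrib[OF Px Rx cx] x by simp
  have sq: "(P *\<^sub>v x) \<bullet>c (P *\<^sub>v x) = (R *\<^sub>v x) \<bullet>c (R *\<^sub>v x)"
  proof -
    have "(P *\<^sub>v x) \<bullet>c (P *\<^sub>v x) = (P * P *\<^sub>v x) \<bullet>c x"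
      using cscalar_prod_adjoint[OF P(1) Px x] assoc_mult_mat_vec[OF P(1) P(1) x] Ph by simp
    also have "\<dots> = (R *\<^sub>v x) \<bullet>c (R *\<^sub>v x)"
      using cscalar_prod_adjoint[OF R(1) Rx x] assoc_mult_mat_vec[OF R(1) R(1) x] Rh eq by simp
    finally show ?thesis .
  qed
  have "of_real r * ?p = (P *\<^sub>v x) \<bullet>c (P *\<^sub>v x - R *\<^sub>v x)"
    unfolding Xx using Px x by (simp add: conjugate_smult_vec)
  also have "\<dots> = (P *\<^sub>v x) \<bullet>c (P *\<^sub>v x) - (P *\<^sub>v x) \<bullet>c (R *\<^sub>v x)"
    using cscalar_prod_minus_right[OF Px Px Rx] .
  finally have rp: "of_real r * ?p = \<dots>" .
  have "of_real r * ?q = of_real r * (x \<bullet>c (R *\<^sub>v x))"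
    using cscalar_prod_adjoint[OF R(1) x x] Rh by simp
  also have "\<dots> = (P *\<^sub>v x - R *\<^sub>v x) \<bullet>c (R *\<^sub>v x)"
    unfolding Xx using Rx x by simp
  also have "\<dots> = (P *\<^sub>v x) \<bullet>c (R *\<^sub>v x) - (R *\<^sub>v x) \<bullet>c (R *\<^sub>v x)"
    using minus_scalar_prod_distrib[OF Px Rx] Rx by simp
  finally have sum: "of_real r * (?p + ?q) = 0"
    using rp sq by (simp add: distrib_left)
  show "r = 0 \<or> x = 0\<^sub>v n"
  proof (rule disjCI)
    assume "x \<noteq> 0\<^sub>v n"
    show "r = 0"
    proof (rule ccontr)
      assume r: "r \<noteq> 0"
      have "Re ?p \<ge> 0" "Re ?q \<ge> 0" using P R x by (auto simp: psd_mat_def)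
      moreover have "Re ?p + Re ?q = 0" using sum r by (simp add: complex_eq_iff)
      ultimately have "Re (?p - ?q) = 0" by simp
      thus False
        unfolding diff using r Re_cscalar_prod_self_eq_0_iff[OF x] \<open>x \<noteq> 0\<^sub>v n\<close> by simp
    qed
  qed
qed

text \<open>A unitary Hermitian matrix squares to the identity, so both \<open>U\<close> and \<open>1\<close> are positive
  semidefinite square roots of \<open>1\<close>.\<close>

lemma psd_unitary_eq_one:
  assumes U: "U \<in> carrier_mat n n" "psd_mat U" "unitary_mat U"
  shows "U = 1\<^sub>m n"
proof (rule psd_sqrt_unique[OF U(1,2) one_carrier_mat psd_mat_one])
  show "U * U = 1\<^sub>m n * 1\<^sub>m n"
    using unitary_matD[OF U(1,3)] U(2) by (simp add: psd_mat_def)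
qed

lemma mat_modulus_properties:
  fixes T :: "complex mat"
  assumes T: "T \<in> carrier_mat m n"
  shows "mat_modulus T \<in> carrier_mat n n" "psd_mat (mat_modulus T)"
    "mat_modulus T * mat_modulus T = mat_adjoint T * T"
proof -
  have "\<exists>!P. P \<in> carrier_mat n n \<and> psd_mat P \<and> P * P = mat_adjoint T * T"
    using psd_sqrt_exists[OF T] psd_sqrt_unique by (metis (no_types, lifting))
  from theI'[OF this] T
  show "mat_modulus T \<in> carrier_mat n n" "psd_mat (mat_modulus T)"
    "mat_modulus T * mat_modulus T = mat_adjoint T * T"
    by (auto simp: mat_modulus_def)
qed

section \<open>Uniqueness of the polar factor\<close>

text \<open>The difference \<open>X\<close> of two polar factors satisfies \<open>X P = 0\<close> with \<open>P = |T|\<close>, hence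
  \<open>P X\<^sup>* = 0\<close>: the range of \<open>X\<^sup>*\<close> lies in \<open>ker P \<subseteq> ker T\<close>, on which both factors vanish. Thus
  \<open>X X\<^sup>* = 0\<close> and \<open>X = 0\<close>.\<close>

lemma polar_decomposition_unique:
  assumes T: "T \<in> carrier_mat n n" and V: "polar_decomposition T V" and W: "polar_decomposition T W"
  shows "V = W"
proof -
  let ?P = "mat_modulus T"
  have Vc: "V \<in> carrier_mat n n" and Wc: "W \<in> carrier_mat n n"
    using T V W by (auto simp: polar_decomposition_def)
  note P = mat_modulus_properties[OF T]
  have Ph: "mat_adjoint ?P = ?P" using P(2) by (simp add: psd_mat_def)
  define X where "X = V - W"
  have X: "X \<in> carrier_mat n n" unfolding X_def using Wc by (rule minus_carrier_mat)
  note adjX = mat_adjoint_carrier[OF X]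
  have TV: "T = V * ?P" and TW: "T = W * ?P"
    and kV: "mat_kernel V = mat_kernel T" and kW: "mat_kernel W = mat_kernel T"
    using V W by (auto simp: polar_decomposition_def)
  have "X * ?P = T - T" 
    unfolding X_def using minus_mult_distrib_mat[OF Vc Wc P(1)] TV TW by simp
  hence XP: "X * ?P = 0\<^sub>m n n" using T by simp
  have "?P * mat_adjoint X = mat_adjoint (X * ?P)"
    using mat_adjoint_mult[OF X P(1)] Ph by simp
  also have "\<dots> = 0\<^sub>m n n" unfolding XP by (rule eq_matI) auto
  finally have PX: "?P * mat_adjoint X = 0\<^sub>m n n" .
  have "X * mat_adjoint X = 0\<^sub>m n n"
  proof (rule mat_eq_0_if_mult_vec_0)
    show "X * mat_adjoint X \<in> carrier_mat n n" using X adjX by (rule mult_carrier_mat)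
    fix x :: "complex vec" assume x: "x \<in> carrier_vec n"
    let ?y = "mat_adjoint X *\<^sub>v x"
    have y: "?y \<in> carrier_vec n" using adjX x by simp
    have "?P *\<^sub>v ?y = 0\<^sub>v n"
      using assoc_mult_mat_vec[OF P(1) adjX x] PX x by simp
    hence "T *\<^sub>v ?y = 0\<^sub>v n"
      using TV assoc_mult_mat_vec[OF Vc P(1) y] Vc by simp
    hence "?y \<in> mat_kernel T" using mat_kernelI[OF T y] by simp
    hence "V *\<^sub>v ?y = 0\<^sub>v n" "W *\<^sub>v ?y = 0\<^sub>v n"
      using mat_kernelD[OF Vc] mat_kernelD[OF Wc] kV kW by auto
    thus "X * mat_adjoint X *\<^sub>v x = 0\<^sub>v n"
      using assoc_mult_mat_vec[OF X adjX x] minus_mult_distrib_mat_vec[OF Vc Wc y]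
      by (simp add: X_def)
  qed
  hence "mat_adjoint X = 0\<^sub>m n n"
    using eq_0_if_adjoint_mult_self_eq_0[OF adjX] by simp
  hence "X = mat_adjoint (0\<^sub>m n n)" using mat_adjoint_adjoint[of X] by simp
  also have "\<dots> = 0\<^sub>m n n" by (rule eq_matI) auto
  finally show ?thesis using minus_mat_eq_0D[OF Vc Wc] by (simp add: X_def)
qed

lemma polar_factor_eq:
  assumes "T \<in> carrier_mat n n" "polar_decomposition T V"
  shows "polar_factor T = V"
  unfolding polar_factor_def
  using assms polar_decomposition_unique by (intro the_equality) blast+

section \<open>The homogeneous Sylvester equation\<close>

text \<open>Write \<open>B S = S D\<close> with \<open>D\<close> upper triangular and put \<open>Y = X S\<close>, so that \<open>A Y = Y D\<close>. Once the
  columns of \<open>Y\<close> before the \<open>j\<close>-th are known to vanish, the \<open>j\<close>-th one is mapped by \<open>A\<close> to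
  \<open>D\<^sub>j\<^sub>j\<close> times itself; as \<open>D\<^sub>j\<^sub>j\<close> is an eigenvalue of \<open>B\<close> and not of \<open>A\<close>, it vanishes too.\<close>

lemma sylvester_unique:
  fixes A B X :: "complex mat"
  assumes A: "A \<in> carrier_mat m m" and B: "B \<in> carrier_mat n n" and X: "X \<in> carrier_mat m n"
    and eq: "A * X = X * B" and disj: "spectrum A \<inter> spectrum B = {}"
  shows "X = 0\<^sub>m m n"
proof -
  obtain es where es: "char_poly B = (\<Prod>a\<leftarrow>es. [:- a, 1:])"
    using char_poly_factorized[OF B] by blast
  obtain D S Q where "schur_decomposition B es = (D, S, Q)"
    by (cases "schur_decomposition B es") auto
  from schur_decomposition[OF B es this] have sim: "similar_mat_wit B D S Q"
    and ut: "upper_triangular D" by auto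
  note w = similar_mat_witD2[OF B sim]
  have SQ: "S * Q = 1\<^sub>m n" and QS: "Q * S = 1\<^sub>m n" and BS: "B = S * D * Q"
    and D: "D \<in> carrier_mat n n" and S: "S \<in> carrier_mat n n" and Q: "Q \<in> carrier_mat n n"
    using w by auto
  have diag: "D $$ (j, j) \<in> spectrum B" if "j < n" for j
  proof -
    have "char_poly B = char_poly D"
      using sim by (intro char_poly_similar) (auto simp: similar_mat_def)
    also have "\<dots> = (\<Prod>a\<leftarrow>diag_mat D. [:- a, 1:])"
      by (rule char_poly_upper_triangular[OF D ut])
    finally have "poly (char_poly B) (D $$ (j, j)) = 0"
      using that D by (auto simp: poly_prod_list prod_list_zero_iff diag_mat_def)
    thus ?thesis using spectrum_root_char_poly[OF B] by simp
  qed
  define Y where "Y = X * S"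
  have Y: "Y \<in> carrier_mat m n" using X S by (simp add: Y_def)
  have "B * S = S * D"
    using S D Q by (simp add: BS assoc_mult_mat[of _ n n _ n _ n] QS right_mult_one_mat[of _ n n])
  hence AY: "A * Y = Y * D"
    using eq A B X S D unfolding Y_def
    by (simp add: assoc_mult_mat[OF A X S, symmetric] assoc_mult_mat[OF X B S] assoc_mult_mat[OF X S D])
  have "col Y j = 0\<^sub>v m" if "j < n" for j
    using that
  proof (induction j rule: less_induct)
    case (less j)
    have Yk: "Y $$ (i, k) = 0" if "i < m" "k < j" for i k
      using arg_cong[OF less.IH[OF that(2)], of "\<lambda>v. v $ i"] that less.prems Y by simp
    let ?y = "col Y j"
    have y: "?y \<in> carrier_vec m" using Y by auto
    have "A *\<^sub>v ?y = col (Y * D) j" using col_mult2[OF A Y less.prems] AY by simp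
    also have "\<dots> = D $$ (j, j) \<cdot>\<^sub>v ?y"
    proof (rule eq_vecI)
      fix i assume "i < dim_vec (D $$ (j, j) \<cdot>\<^sub>v ?y)"
      hence i: "i < m" using Y by simp
      have "col (Y * D) j $ i = (\<Sum>k<n. Y $$ (i, k) * D $$ (k, j))"
        using Y D i less.prems by (simp add: scalar_prod_def atLeast0LessThan)
      also have "\<dots> = (\<Sum>k<n. if k = j then Y $$ (i, j) * D $$ (j, j) else 0)"
      proof (rule sum.cong)
        fix k assume k: "k \<in> {..<n}"
        consider "k < j" | "k = j" | "j < k" by linarith
        thus "Y $$ (i, k) * D $$ (k, j) = (if k = j then Y $$ (i, j) * D $$ (j, j) else 0)"
        proof cases
          case 3
          hence "D $$ (k, j) = 0" using ut D k by (auto simp: upper_triangular_def)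
          thus ?thesis using 3 by simp
        qed (use Yk[OF i] in auto)
      qed simp
      finally show "col (Y * D) j $ i = (D $$ (j, j) \<cdot>\<^sub>v ?y) $ i"
        using Y i less.prems by simp
    qed (use Y D in auto)
    finally have ev: "A *\<^sub>v ?y = D $$ (j, j) \<cdot>\<^sub>v ?y" .
    show ?case
    proof (rule ccontr)
      assume "?y \<noteq> 0\<^sub>v m"
      hence "D $$ (j, j) \<in> spectrum A"
        using ev y A by (auto simp: spectrum_def eigenvalue_def eigenvector_def)
      thus False using disj diag[OF less.prems] by blast
    qed
  qed
  hence "Y = 0\<^sub>m m n" by (intro mat_col_eqI) (use Y in auto)
  hence "X * S * Q = 0\<^sub>m m n" using Q by (simp add: Y_def)
  thus ?thesis using X assoc_mult_mat[OF X S Q] SQ by simp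
qed

text \<open>A common eigenvalue \<open>a\<close> of \<open>V\<close> and \<open>- V\<close> would give the opposite eigenvalues \<open>a\<close> and
  \<open>- a\<close> of \<open>V\<close>. These are distinct because a unitary matrix does not have the eigenvalue \<open>0\<close>.\<close>

lemma anticommuting_mat_eq_0:
  assumes V: "V \<in> carrier_mat n n" "unitary_mat V" and X: "X \<in> carrier_mat n n"
    and anti: "V * X = X * - V"
    and sp: "\<And>a b. a \<in> spectrum V \<Longrightarrow> b \<in> spectrum V \<Longrightarrow> a \<noteq> b \<Longrightarrow> a + b \<noteq> 0"
  shows "X = 0\<^sub>m n n"
proof (rule sylvester_unique[OF V(1) _ X anti])
  show "- V \<in> carrier_mat n n" using V by simp
  have "False" if a: "a \<in> spectrum V" and a': "a \<in> spectrum (- V)" for a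
  proof -
    obtain v where v: "v \<in> carrier_vec n" "v \<noteq> 0\<^sub>v n" and "- V *\<^sub>v v = a \<cdot>\<^sub>v v"
      using a' V(1) by (auto simp: spectrum_def eigenvalue_def eigenvector_def)
    hence "- (V *\<^sub>v v) = a \<cdot>\<^sub>v v" using V(1) by simp
    hence "- (- (V *\<^sub>v v)) = - (a \<cdot>\<^sub>v v)" by simp
    hence Vv: "V *\<^sub>v v = (- a) \<cdot>\<^sub>v v" by (auto intro!: eq_vecI)
    hence "- a \<in> spectrum V"
      using v V(1) by (auto simp: spectrum_def eigenvalue_def eigenvector_def)
    hence "a = 0" using sp[OF a, of "- a"] by auto
    hence "V *\<^sub>v v = 0\<^sub>v n" using Vv v(1) by (auto intro!: eq_vecI)
    hence "mat_adjoint V * V *\<^sub>v v = 0\<^sub>v n"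
      using assoc_mult_mat_vec[OF mat_adjoint_carrier[OF V(1)] V(1) v(1)] mat_adjoint_carrier[OF V(1)]
      by simp
    thus False using unitary_matD[OF V] v by simp
  qed
  thus "spectrum V \<inter> spectrum (- V) = {}" by blast
qed

section \<open>Unitary mean transforms\<close>

theorem theorem4p5:
  fixes T V :: "complex mat" and n :: nat
  assumes "T \<in> carrier_mat n n"
    and "polar_decomposition T V"
    and "\<And>a b. a \<in> spectrum V \<Longrightarrow> b \<in> spectrum V \<Longrightarrow> a \<noteq> b \<Longrightarrow> a + b \<noteq> 0"
  shows "unitary_mat (mean_transform T) \<longleftrightarrow> T = V \<and> unitary_mat T"
proof -
  define P where "P = mat_modulus T"
  note T = assms(1)
  note P = mat_modulus_properties[OF T, folded P_def]
  have V: "V \<in> carrier_mat n n" and TV: "T = V * P" and iso: "partial_isometry V"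
    and ker: "mat_kernel V = mat_kernel T"
    using assms(1,2) by (auto simp: polar_decomposition_def P_def)
  note adjV [simp] = mat_adjoint_carrier[OF V]
  define M where "M = mean_transform T"
  have M_eq: "M = (1 / 2) \<cdot>\<^sub>m (T + P * V)"
    by (simp add: M_def mean_transform_def polar_factor_eq[OF assms(1,2)] P_def)
  have M: "M \<in> carrier_mat n n" unfolding M_eq using T P(1) V by simp
  have "T = V \<and> unitary_mat T" if Mu: "unitary_mat M"
  proof -
    \<comment> \<open>The kernel of \<open>V\<close> is that of \<open>T\<close>, on which both \<open>T\<close> and \<open>P V\<close> vanish.\<close>
    have kerV: "x = 0\<^sub>v n" if x: "x \<in> mat_kernel V" for x
    proof -
      have xc: "x \<in> carrier_vec n" and Vx: "V *\<^sub>v x = 0\<^sub>v n" using mat_kernelD[OF V x] by auto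
      have Tx: "T *\<^sub>v x = 0\<^sub>v n" using x ker mat_kernelD[OF T] by simp
      have "(T + P * V) *\<^sub>v x = 0\<^sub>v n"
        using add_mult_distrib_mat_vec[OF T mult_carrier_mat[OF P(1) V] xc]
          assoc_mult_mat_vec[OF P(1) V xc] Vx Tx P(1) by simp
      hence "M *\<^sub>v x = 0\<^sub>v n"
        using T P(1) V xc unfolding M_eq by (auto intro!: eq_vecI simp: vec_eq_iff)
      hence "mat_adjoint M * M *\<^sub>v x = 0\<^sub>v n"
        using assoc_mult_mat_vec[OF mat_adjoint_carrier[OF M] M xc] mat_adjoint_carrier[OF M] by simp
      thus ?thesis using unitary_matD[OF M Mu] xc by simp
    qed
    have Vu: "unitary_mat V"
    proof (rule unitary_if_norm_preserving[OF V])
      fix x :: "complex vec" assume x: "x \<in> carrier_vec n"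
      have "\<forall>y\<in>mat_kernel V. x \<bullet>c y = 0"
        using kerV x by (metis conjugate_zero_vec scalar_prod_right_zero)
      thus "eucl_norm (V *\<^sub>v x) = eucl_norm x"
        using iso x V by (auto simp: partial_isometry_def)
    qed
    \<comment> \<open>\<open>V\<^sup>* M\<close> is the average of \<open>P\<close> and \<open>V\<^sup>* P V\<close>, hence positive as well as unitary.\<close>
    define U where "U = mat_adjoint V * M"
    have U: "U \<in> carrier_mat n n" using M by (simp add: U_def)
    have "U = (1 / 2) \<cdot>\<^sub>m (mat_adjoint V * T + mat_adjoint V * (P * V))"
      unfolding U_def M_eq using T P(1) V 
      by (simp add: mult_smult_distrib[of _ n n _ n] mult_add_distrib_mat[of _ n n _ n])
    also have "mat_adjoint V * T = P"
      unfolding TV using assoc_mult_mat[OF adjV V P(1)] unitary_matD[OF V Vu] P(1) by simp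
    finally have "psd_mat U"
      using psd_mat_midpoint[OF P(1,2) _ psd_mat_congruence[OF P(1,2) V]] P(1) V by simp
    moreover have "unitary_mat U"
      unfolding U_def using unitary_mat_mult[OF adjV unitary_mat_adjoint[OF V Vu] M Mu] .
    ultimately have "U = 1\<^sub>m n" using psd_unitary_eq_one[OF U] by simp
    moreover have "V * U = M"
      unfolding U_def using assoc_mult_mat[OF V adjV M] unitary_matD[OF V Vu] M by simp
    ultimately have MV: "M = V" using V by simp
    \<comment> \<open>Now \<open>V P + P V = 2 V\<close>, that is, \<open>P - 1\<close> anticommutes with \<open>V\<close>.\<close>
    define X where "X = P - 1\<^sub>m n"
    have X: "X \<in> carrier_mat n n" unfolding X_def by (rule minus_carrier_mat) simp
    have VX: "V * X = T - V"
      unfolding X_def using mult_minus_distrib_mat[OF V P(1) one_carrier_mat] TV V by simp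
    have XV: "X * V = P * V - V"
      unfolding X_def using minus_mult_distrib_mat[OF P(1) one_carrier_mat V] V by simp
    have XV': "X * - V = - (X * V)" using X V by simp
    have "V * X = X * - V"
      unfolding VX XV' XV
    proof (rule eq_matI)
      fix i j assume "i < dim_row (- (P * V - V))" "j < dim_col (- (P * V - V))"
      hence ij: "i < n" "j < n" using V by auto
      have "(T $$ (i, j) + (P * V) $$ (i, j)) / 2 = V $$ (i, j)"
        using arg_cong[OF MV, of "\<lambda>A. A $$ (i, j)"] M_eq T V P(1) ij by (simp del: index_mult_mat(1))
      thus "(T - V) $$ (i, j) = (- (P * V - V)) $$ (i, j)"
        using T V P(1) ij by (simp add: field_simps del: index_mult_mat(1))
    qed (use T V P(1) in auto)
    from anticommuting_mat_eq_0[OF V Vu X this assms(3)] have "P = 1\<^sub>m n"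
      using minus_mat_eq_0D[OF P(1) one_carrier_mat] by (simp add: X_def)
    hence "T = V" using TV V by simp
    thus ?thesis using Vu by simp
  qed
  moreover have "unitary_mat M" if "T = V" and Tu: "unitary_mat T"
  proof -
    have "P * P = 1\<^sub>m n * 1\<^sub>m n" using P(3) unitary_matD[OF T Tu] by simp
    hence "P = 1\<^sub>m n" using psd_sqrt_unique[OF P(1,2) one_carrier_mat psd_mat_one] by blast
    hence "M = (1 / 2) \<cdot>\<^sub>m (T + T)" using M_eq \<open>T = V\<close> V by simp
    also have "\<dots> = T" by (rule eq_matI) auto
    finally show ?thesis using Tu by simp
  qed
  ultimately show ?thesis unfolding M_def by blast
qed

end
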